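(* Let $\mathcal G=(L\cup R,\mathcal E)$ be a GNN computation graph, and let $\hat{\mathcal P}$ be a partial HAG computation graph (with vertex set $L\cup M$). Let $H=H(\hat{\mathcal P},\mathcal G)$ be the associated weighted hypergraph. Let $\mathcal M(H)$ denote the set of matchings in $H$. Then there is a bijection $$\varphi:\mathcal M(H)\to\mathcal S(\hat{\mathcal P},\mathcal G)$$ so that for a matching $\mathcal N\in\mathcal M(H)$, $$\mathrm{value}(\varphi(\mathcal N))=\mathrm{value}(\mathcal N)-c(\hat{\mathcal P}),$$ where the value of a matching is defined as the sum of the weights of the edges in that matching, and where $c(\hat{\mathcal P})$ is a constant that depends only on the partial HAG graph $\hat{\mathcal P}$. When $\hat{\mathcal P}$ is a partial $d$-HAG graph with $k$ intermediate nodes, $c(\hat{\mathcal P})=k(d-1)$. In particular, if $\mathcal N$ is a maximum weighted hypergraph matching for $H$, then $\varphi(\mathcal N)$ is a maximum value HAG computation graph in $\mathcal S(\hat{\mathcal P},\mathcal G)$.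
   Context: GNN computation graph. For a directed graph $G=(V,E)$, the GNN computation graph $\mathcal G=(L\cup R,\mathcal E)$ is the bipartite graph where $L$ and $R$ are copies of $V$ and $(u_L,v_R)\in\mathcal E$ if and only if $(u,v)\in E$. $\Gamma_{in}(v)$ is the set of in-neighbors of $v$ in $\mathcal G$. HAG computation graph. A HAG computation graph for $G$ is a directed acyclic graph $\hat{\mathcal G}=(L\cup M\cup R,\hat{\mathcal E})$, where $L$ and $R$ are copies of $V$ and $M$ is a set of intermediate nodes, with directed edges from $L$ to $M$, from $M$ to $R$, and possibly within $M$ (edges directly from $L$ to $R$ are also permitted), such that for every directed edge $(u,v)\in E$ there is a unique directed path from $u_L$ to $v_R$ in $\hat{\mathcal G}$. $\hat\Gamma_{in}(v)$ and $\hat\Gamma_{out}(v)$ are the sets of in-neighbors and out-neighbors of $v$ in $\hat{\mathcal G}$. If $|\hat\Gamma_{in}(w)|=d$ for all $w\in M$, it is a $d$-HAG computation graph. $\mathcal G$ and $\hat{\mathcal G}$ are equivalent if they are computation graphs for the same underlying graph $G$. Cover. For a vertex $v$ of $\hat{\mathcal G}$, $\mathrm{cover}(v)=\{w\in L:\text{there is a directed path from }w\text{ to }v\text{ in }\hat{\mathcal G}\}$ (so $\mathrm{cover}(v)=\{v\}$ for $v\in L$). It is assumed that distinct $m\in M$ have distinct covers. Equivalence of $\mathcal G$ and $\hat{\mathcal G}$ is understood to give that, for $r\in R$, $\Gamma_{in}(r)$ is the disjoint union of the sets $\mathrm{cover}(v)$, $v\in\hat\Gamma_{in}(r)$. Value.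 The cost of a computation graph with vertex set $\mathcal V$ and right-hand side $R$ is $\mathrm{cost}=c_{Agg}\sum_{w\in\mathcal V}(|\text{in-neighbors of }w|-1)+c_{Up}|R|$, where $c_{Agg},c_{Up}$ are constants (costs of an aggregation and an update). For $\hat{\mathcal G}$ equivalent to $\mathcal G$, $$\mathrm{value}(\hat{\mathcal G})=\frac1{c_{Agg}}\left(\mathrm{cost}(\mathcal G)-\mathrm{cost}(\hat{\mathcal G})\right)=\sum_{v\in M}\left[|\hat\Gamma_{out}(v)|(|\mathrm{cover}(v)|-1)-(|\hat\Gamma_{in}(v)|-1)\right].$$ Partial HAG computation graph. The partial HAG computation graph induced by a HAG computation graph $\hat{\mathcal G}=(L\cup M\cup R,\hat{\mathcal E})$ is its induced subgraph on $L\cup M$ (its edges are the edges of $\hat{\mathcal G}$ from $L$ to $M$ and within $M$). It is a partial $d$-HAG graph if every node of $M$ has in-degree $d$; the nodes of $M$ are its intermediate nodes. $\mathcal S(\hat{\mathcal P},\mathcal G)$ denotes the set of HAG computation graphs $\hat{\mathcal G}$ on the vertices $L\cup M\cup R$ such that $\hat{\mathcal G}$ is equivalent to $\mathcal G$ and $\hat{\mathcal P}$ is the partial HAG computation graph induced by $\hat{\mathcal G}$. Hypergraph. For $r\in R$, $H_r=H_r(\hat{\mathcal P},\mathcal G)$ is the hypergraph with vertices $L$ and edges $\{\mathrm{cover}(v):v\in M\text{ and }\mathrm{cover}(v)\subseteq\Gamma_{in}(r)\}$; the edge $e=\mathrm{cover}(v)$ has weight $|\mathrm{cover}(v)|-1$.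 $H=H(\hat{\mathcal P},\mathcal G)$ is the disjoint union of the $H_r$ for $r\in R$ (its vertices are $|R|$ disjoint copies of $L$, and the edges on the $r$-th copy are those of $H_r$). A matching is a set of pairwise disjoint hyperedges.
   Formalization: Added: each intermediate node giving a hyperedge of H is reached by a unique path from every node of its cover; else an unused doubly reached node gives a matching with no HAG, so no bijection exists. Value is the cost difference, since the second formula can differ when M has internal edges. *)

theory Defs
  imports Complex_Main "Graph_Theory.Pair_Digraph" "Graph_Theory.Digraph_Component"
begin

section \<open>Computation graphs\<close>

text \<open>
  A directed graph without parallel arcs is a value of type \<^typ>\<open>'a pair_pre_digraph\<close>.
  The vertices of all computation graphs are tagged: \<open>Lft v\<close> and \<open>Rgt v\<close> are the two copies
  of the vertex \<open>v\<close> of the underlying graph, and \<open>Mid m\<close> is an intermediate node.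
\<close>

datatype ('v, 'm) node = Lft 'v | Mid 'm | Rgt 'v

definition left_part :: "('v, 'm) node pair_pre_digraph \<Rightarrow> ('v, 'm) node set" where
  "left_part H = pverts H \<inter> range Lft"

definition mid_part :: "('v, 'm) node pair_pre_digraph \<Rightarrow> ('v, 'm) node set" where
  "mid_part H = pverts H \<inter> range Mid"

definition right_part :: "('v, 'm) node pair_pre_digraph \<Rightarrow> ('v, 'm) node set" where
  "right_part H = pverts H \<inter> range Rgt"

definition in_nbrs :: "'a pair_pre_digraph \<Rightarrow> 'a \<Rightarrow> 'a set" where
  "in_nbrs H w = {u. (u, w) \<in> parcs H}"

abbreviation is_path :: "'a pair_pre_digraph \<Rightarrow> 'a \<Rightarrow> ('a \<times> 'a) awalk \<Rightarrow> 'a \<Rightarrow> bool" where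
  "is_path H u p v \<equiv> pre_digraph.apath (with_proj H) u p v"

definition cover :: "('v, 'm) node pair_pre_digraph \<Rightarrow> ('v, 'm) node \<Rightarrow> ('v, 'm) node set" where
  "cover H v = {w \<in> left_part H. w \<rightarrow>\<^sup>*\<^bsub>with_proj H\<^esub> v}"

definition gnn_graph :: "'v pair_pre_digraph \<Rightarrow> ('v, 'm) node pair_pre_digraph" where
  "gnn_graph G =
     \<lparr> pverts = Lft ` pverts G \<union> Rgt ` pverts G,
       parcs = {(Lft u, Rgt v) | u v. (u, v) \<in> parcs G} \<rparr>"

text \<open>
  \<open>is_hag G H\<close>: \<open>H\<close> is a HAG computation graph for \<open>G\<close>. An arc of \<open>G\<close> gives a unique path,
  and a non-arc gives no path; thus \<open>cover H (Rgt v)\<close> is the in-neighbourhood of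
  \<open>Rgt v\<close> in \<open>gnn_graph G\<close>, and it is the disjoint union of the covers of the in-neighbours of
  \<open>Rgt v\<close> in \<open>H\<close>. The last conjunct is the standing assumption that intermediate nodes have
  distinct covers.
\<close>

definition is_hag :: "'v pair_pre_digraph \<Rightarrow> ('v, 'm) node pair_pre_digraph \<Rightarrow> bool" where
  "is_hag G H \<longleftrightarrow>
     finite (pverts H) \<and>
     left_part H = Lft ` pverts G \<and>
     right_part H = Rgt ` pverts G \<and>
     parcs H \<subseteq> left_part H \<times> mid_part H \<union> mid_part H \<times> mid_part H
              \<union> mid_part H \<times> right_part H \<union> left_part H \<times> right_part H \<and>
     acyclic (parcs H) \<and>
     (\<forall>u \<in> pverts G. \<forall>v \<in> pverts G.
        ((u, v) \<in> parcs G \<longrightarrow> (\<exists>!p. is_path H (Lft u) p (Rgt v))) \<and>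
        ((u, v) \<notin> parcs G \<longrightarrow> \<not> (\<exists>p. is_path H (Lft u) p (Rgt v)))) \<and>
     inj_on (cover H) (mid_part H)"

text \<open>\<open>induces H P\<close>: \<open>P\<close> is the subgraph of \<open>H\<close> induced on the left and intermediate nodes.\<close>

definition induces ::
    "('v, 'm) node pair_pre_digraph \<Rightarrow> ('v, 'm) node pair_pre_digraph \<Rightarrow> bool" where
  "induces H P \<longleftrightarrow> with_proj P = with_proj H \<restriction> (left_part H \<union> mid_part H)"

definition partial_hag :: "('v, 'm) node pair_pre_digraph \<Rightarrow> bool" where
  "partial_hag P \<longleftrightarrow> (\<exists>G H. pair_fin_digraph G \<and> is_hag G H \<and> induces H P)"

definition partial_d_hag :: "nat \<Rightarrow> ('v, 'm) node pair_pre_digraph \<Rightarrow> bool" where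
  "partial_d_hag d P \<longleftrightarrow> partial_hag P \<and> (\<forall>w \<in> mid_part P. card (in_nbrs P w) = d)"

definition hags_extending ::
    "('v, 'm) node pair_pre_digraph \<Rightarrow> 'v pair_pre_digraph \<Rightarrow> ('v, 'm) node pair_pre_digraph set" where
  "hags_extending P G = {H. is_hag G H \<and> induces H P}"

text \<open>In the cost, left nodes and other sources contribute \<open>-1\<close> to the sum.\<close>

definition cost :: "real \<Rightarrow> real \<Rightarrow> ('v, 'm) node pair_pre_digraph \<Rightarrow> real" where
  "cost cAgg cUp H =
     cAgg * (\<Sum>w \<in> pverts H. real (card (in_nbrs H w)) - 1) + cUp * real (card (right_part H))"

definition hag_value ::
    "real \<Rightarrow> real \<Rightarrow> 'v pair_pre_digraph \<Rightarrow> ('v, 'm) node pair_pre_digraph \<Rightarrow> real" where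
  "hag_value cAgg cUp G H =
     1 / cAgg * (cost cAgg cUp (gnn_graph G :: ('v, 'm) node pair_pre_digraph) - cost cAgg cUp H)"


section \<open>Weighted hypergraphs\<close>

text \<open>
  Edges are labels with a vertex set \<open>hends e\<close>, so that in a disjoint union the edges from
  different summands stay distinct even when their vertex sets are empty.
\<close>

record ('x, 'e) hypergraph =
  hverts :: "'x set"
  hedges :: "'e set"
  hends :: "'e \<Rightarrow> 'x set"
  hweight :: "'e \<Rightarrow> real"

definition hyper_disjoint_union ::
    "'i set \<Rightarrow> ('i \<Rightarrow> ('x, 'e) hypergraph) \<Rightarrow> ('i \<times> 'x, 'i \<times> 'e) hypergraph" where
  "hyper_disjoint_union I F =
     \<lparr> hverts = (SIGMA i:I. hverts (F i)),
       hedges = (SIGMA i:I. hedges (F i)),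
       hends = (\<lambda>(i, e). {i} \<times> hends (F i) e),
       hweight = (\<lambda>(i, e). hweight (F i) e) \<rparr>"

definition matchings :: "('x, 'e) hypergraph \<Rightarrow> 'e set set" where
  "matchings H = {N. N \<subseteq> hedges H \<and> pairwise (\<lambda>e f. disjnt (hends H e) (hends H f)) N}"

definition matching_value :: "('x, 'e) hypergraph \<Rightarrow> 'e set \<Rightarrow> real" where
  "matching_value H N = (\<Sum>e \<in> N. hweight H e)"

definition cover_hypergraph_at ::
    "('v, 'm) node pair_pre_digraph \<Rightarrow> 'v pair_pre_digraph \<Rightarrow> ('v, 'm) node \<Rightarrow>
     (('v, 'm) node, ('v, 'm) node set) hypergraph" where
  "cover_hypergraph_at P G r =
     \<lparr> hverts = left_part P,
       hedges = {cover P v | v. v \<in> mid_part P \<and> cover P v \<subseteq> in_nbrs (gnn_graph G) r},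
       hends = (\<lambda>e. e),
       hweight = (\<lambda>e. real (card e) - 1) \<rparr>"

definition cover_hypergraph ::
    "('v, 'm) node pair_pre_digraph \<Rightarrow> 'v pair_pre_digraph \<Rightarrow>
     (('v, 'm) node \<times> ('v, 'm) node, ('v, 'm) node \<times> ('v, 'm) node set) hypergraph" where
  "cover_hypergraph P G =
     hyper_disjoint_union (right_part (gnn_graph G)) (cover_hypergraph_at P G)"

text \<open>
  Every intermediate node that yields a hyperedge is reached by a unique path from each left node
  in its cover. In a HAG computation graph this is automatic for the intermediate nodes that
  reach the right-hand side, but not for unused ones: if \<open>m\<close> is unused, reached twice from
  \<open>u\<close>, and its cover lies in the in-neighbourhood of \<open>r\<close>, then the matching consisting of the
  edge of \<open>m\<close> on the copy of \<open>r\<close> would give two paths from \<open>u\<close> to \<open>r\<close>.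
\<close>

definition unambiguous_edges ::
    "('v, 'm) node pair_pre_digraph \<Rightarrow> 'v pair_pre_digraph \<Rightarrow> bool" where
  "unambiguous_edges P G \<longleftrightarrow>
     (\<forall>r \<in> right_part (gnn_graph G). \<forall>v \<in> mid_part P.
        cover P v \<subseteq> in_nbrs (gnn_graph G) r \<longrightarrow>
        (\<forall>u \<in> cover P v. \<exists>!p. is_path P u p v))"

end

theory Submission
  imports Defs
begin

text \<open>
  A HAG computation graph extending \<open>P\<close> is determined by its arcs into the right-hand side. Such a
  set of arcs is admissible iff, for every right node \<open>r\<close>, the covers of the in-neighbours of \<open>r\<close>
  partition the in-neighbourhood of \<open>r\<close> in the GNN graph. The parts covered by intermediate nodes
  form a matching in the hypergraph at \<open>r\<close>; conversely, a matching leaves over a set of left nodes,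
  each of which has to be joined to \<open>r\<close> directly. Replacing the elements of a cover \<open>e\<close> by a single
  in-neighbour lowers the in-degree of \<open>r\<close> by \<open>card e - 1\<close>, the weight of \<open>e\<close>, while the in-degrees
  in \<open>P\<close> are fixed.
\<close>

section \<open>Walks in acyclic digraphs and in predecessor-closed subgraphs\<close>

abbreviation is_walk :: "'a pair_pre_digraph \<Rightarrow> 'a \<Rightarrow> ('a \<times> 'a) awalk \<Rightarrow> 'a \<Rightarrow> bool" where
  "is_walk H u p v \<equiv> pre_digraph.awalk (with_proj H) u p v"

text \<open>Walks are taken apart at their last arc, because graphs extending \<open>P\<close>
  differ only in arcs into right nodes, and such an arc can only be the last one of a walk.\<close>

lemma (in pair_wf_digraph) awalk_snoc_iff:
  "awalk u (p @ [(x, y)]) v \<longleftrightarrow> awalk u p x \<and> (x, y) \<in> parcs G \<and> v = y"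
proof
  assume "awalk u (p @ [(x, y)]) v"
  then have 1: "awalk u p (awlast u p)" and 2: "awalk (awlast u p) [(x, y)] v"
    by simp_all
  from 2 have "awlast u p = x" "(x, y) \<in> parcs G" "v = y"
    by (auto simp: awalk_simps)
  with 1 show "awalk u p x \<and> (x, y) \<in> parcs G \<and> v = y" by simp
next
  assume *: "awalk u p x \<and> (x, y) \<in> parcs G \<and> v = y"
  then have "awalk x [(x, y)] v"
    by (auto simp: awalk_simps dest: in_arcsD2)
  with * show "awalk u (p @ [(x, y)]) v" by (blast intro: awalk_appendI)
qed

text \<open>A repeated vertex would yield a nonempty closed walk. Uniqueness of paths can thus be
  argued with walks, which need no distinctness check when an arc is appended.\<close>

lemma (in pair_wf_digraph) apath_iff_awalk_if_acyclic:
  assumes "acyclic (parcs G)"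
  shows "apath u p v \<longleftrightarrow> awalk u p v"
proof
  assume w: "awalk u p v"
  have "distinct (pawalk_verts u p)"
  proof (rule ccontr)
    assume "\<not> distinct (pawalk_verts u p)"
    from awalk_not_distinct_decomp[OF w this] obtain r w' where "0 < length r" "awalk w' r w'"
      by blast
    then have "(w', w') \<in> (parcs G)\<^sup>+" using reachable1_awalk by auto
    with assms show False by (simp add: acyclic_def)
  qed
  with w show "apath u p v" by (simp add: apath_def)
qed (simp add: apath_def)

text \<open>A walk ending in \<open>P\<close> has never been outside: each arc of \<open>H\<close>
  into a vertex of \<open>P\<close> belongs to \<open>P\<close> and hence starts there. Induction
  runs backwards from the end of the walk.\<close>

lemma awalk_iff_if_predecessor_closed:
  assumes H: "pair_wf_digraph H" and P: "pair_wf_digraph P"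
    and verts: "pverts P \<subseteq> pverts H" and arcs: "\<And>y x. (y, x) \<in> parcs P \<longleftrightarrow> (y, x) \<in> parcs H \<and> x \<in> pverts P"
    and x: "x \<in> pverts P"
  shows "is_walk H u p x \<longleftrightarrow> is_walk P u p x"
proof -
  interpret P: pair_wf_digraph P by (rule P)
  interpret H: pair_wf_digraph H by (rule H)
  from x show ?thesis
  proof (induction p arbitrary: x rule: rev_induct)
    case Nil
    then show ?case using verts by (auto simp: P.awalk_Nil_iff H.awalk_Nil_iff)
  next
    case (snoc a p)
    obtain y z where a: "a = (y, z)" by (cases a)
    have "(y, x) \<in> parcs H \<longleftrightarrow> (y, x) \<in> parcs P" "(y, x) \<in> parcs P \<Longrightarrow> y \<in> pverts P"
      using snoc.prems P.in_arcsD1 by (simp add: arcs, blast)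
    then show ?case unfolding a P.awalk_snoc_iff H.awalk_snoc_iff using snoc.IH by blast
  qed
qed

lemma induces_iff:
  "induces H P \<longleftrightarrow> pverts P = left_part H \<union> mid_part H \<and>
     parcs P = parcs H \<inter> (left_part H \<union> mid_part H) \<times> (left_part H \<union> mid_part H)"
  unfolding induces_def with_proj_def induce_subgraph_def by auto

text \<open>No arc starts in \<open>B\<close>, so a walk that enters \<open>B\<close> stops, and a
  closed walk would use arcs of \<open>r\<close> only.\<close>

lemma acyclic_Un_sinks:
  assumes "acyclic r" and "s \<subseteq> A \<times> B" and "A \<inter> B = {}" and "r \<subseteq> A \<times> A"
  shows "acyclic (r \<union> s)"
proof -
  have "(x, y) \<in> (r \<union> s)\<^sup>+ \<Longrightarrow> (x, y) \<in> r\<^sup>+ \<and> x \<in> A \<and> y \<in> A \<or> x \<in> A \<and> y \<in> B" for x y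
  proof (induction rule: trancl_induct)
    case (base y)
    then show ?case using assms by blast
  next
    case (step y z)
    then show ?case using assms by (blast intro: trancl_into_trancl)
  qed
  then show ?thesis using assms(1,3) unfolding acyclic_def by blast
qed

section \<open>Extensions of a partial graph by arcs into right nodes\<close>

definition attach ::
    "('v, 'm) node pair_pre_digraph \<Rightarrow> 'v pair_pre_digraph \<Rightarrow>
     (('v, 'm) node \<times> ('v, 'm) node) set \<Rightarrow> ('v, 'm) node pair_pre_digraph" where
  "attach P G B = \<lparr> pverts = pverts P \<union> Rgt ` pverts G, parcs = parcs P \<union> B \<rparr>"

text \<open>A hyperedge names a cover and not a node, so the first set joins every intermediate node
  with that cover to \<open>r\<close>; distinctness of covers makes this a single node. The second
  set joins the left nodes that the matching leaves over.\<close>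

definition matching_arcs ::
    "('v, 'm) node pair_pre_digraph \<Rightarrow> 'v pair_pre_digraph \<Rightarrow>
     (('v, 'm) node \<times> ('v, 'm) node set) set \<Rightarrow> (('v, 'm) node \<times> ('v, 'm) node) set" where
  "matching_arcs P G N =
     {(x, r). x \<in> mid_part P \<and> (r, cover P x) \<in> N} \<union>
     {(Lft u, Rgt v) | u v. (u, v) \<in> parcs G \<and> (\<forall>e. (Rgt v, e) \<in> N \<longrightarrow> Lft u \<notin> e)}"

text \<open>The properties of \<open>P\<close> inherited from a graph that induces it, stated
  without that graph. Only \<open>left_P\<close> relates \<open>P\<close> to
  \<open>G\<close>.\<close>

locale partial_extension =
  fixes P :: "('v, 'm) node pair_pre_digraph" and G :: "'v pair_pre_digraph"
  assumes finite_G: "finite (pverts G)"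
    and arcs_G: "parcs G \<subseteq> pverts G \<times> pverts G"
    and finite_P: "finite (pverts P)"
    and verts_P: "pverts P = left_part P \<union> mid_part P"
    and arcs_P: "parcs P \<subseteq> pverts P \<times> mid_part P"
    and acyclic_P: "acyclic (parcs P)"
    and inj_cover_P: "inj_on (cover P) (mid_part P)"
    and left_P: "left_part P = Lft ` pverts G"
begin

lemma mid_subset: "mid_part P \<subseteq> pverts P"
  by (auto simp: mid_part_def)

lemma Rgt_notin [simp]: "Rgt v \<notin> pverts P"
  using verts_P by (auto simp: left_part_def mid_part_def)

lemma Lft_in_iff: "Lft u \<in> pverts P \<longleftrightarrow> u \<in> pverts G"
  using left_P by (auto simp: left_part_def)

lemma Lft_notin_mid [simp]: "Lft u \<notin> mid_part P"
  by (auto simp: mid_part_def)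

lemma LftE:
  assumes "x \<in> pverts P" and "x \<notin> mid_part P"
  obtains u where "x = Lft u" and "u \<in> pverts G"
  using assms verts_P left_P by auto

lemma wf_P: "pair_wf_digraph P"
  using arcs_P mid_subset by unfold_locales auto

text \<open>By \<open>arcs_P\<close> every arc of \<open>P\<close> ends in an intermediate node, so
  only the empty walk reaches a left node.\<close>

lemma Lft_awalk_iff: "is_walk P u p (Lft v) \<longleftrightarrow> p = [] \<and> u = Lft v \<and> v \<in> pverts G"
proof -
  interpret P: pair_wf_digraph P by (rule wf_P)
  show ?thesis
  proof (cases p rule: rev_exhaust)
    case Nil
    then show ?thesis by (auto simp: P.awalk_Nil_iff Lft_in_iff)
  next
    case (snoc q a)
    then show ?thesis using arcs_P
      by (cases a) (auto simp del: P.awalk_append_iff simp: P.awalk_snoc_iff)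
  qed
qed

lemma cover_iff: "w \<in> cover P x \<longleftrightarrow> w \<in> left_part P \<and> (\<exists>p. is_walk P w p x)"
proof -
  interpret P: pair_wf_digraph P by (rule wf_P)
  show ?thesis by (simp add: cover_def P.reachable_awalk)
qed

lemma cover_Lft: "u \<in> pverts G \<Longrightarrow> cover P (Lft u) = {Lft u}"
  by (auto simp: cover_iff Lft_awalk_iff left_P)

lemma in_nbrs_gnn: "in_nbrs (gnn_graph G) (Rgt v) = {Lft u | u. (u, v) \<in> parcs G}"
  by (auto simp: in_nbrs_def gnn_graph_def)

lemma right_gnn: "right_part (gnn_graph G) = Rgt ` pverts G"
  by (auto simp: right_part_def gnn_graph_def)

lemma attach_parts:
  "left_part (attach P G B) = left_part P"
  "mid_part (attach P G B) = mid_part P"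
  "right_part (attach P G B) = Rgt ` pverts G"
  using Rgt_notin by (auto simp: attach_def left_part_def mid_part_def right_part_def)

context
  fixes B :: "(('v, 'm) node \<times> ('v, 'm) node) set"
  assumes B: "B \<subseteq> pverts P \<times> Rgt ` pverts G"
begin

lemma wf_attach: "pair_wf_digraph (attach P G B)"
  using B arcs_P mid_subset by unfold_locales (auto simp: attach_def)

lemma acyclic_attach: "acyclic (parcs (attach P G B))"
proof -
  have "pverts P \<inter> Rgt ` pverts G = {}" "parcs P \<subseteq> pverts P \<times> pverts P"
    using Rgt_notin arcs_P mid_subset by auto
  then show ?thesis using acyclic_Un_sinks[OF acyclic_P B] by (simp add: attach_def)
qed

lemma induces_attach: "induces (attach P G B) P"
  using B arcs_P mid_subset unfolding induces_iff attach_parts verts_P[symmetric]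
  by (auto simp: attach_def)

lemma awalk_attach_iff:
  assumes "x \<in> pverts P"
  shows "is_walk (attach P G B) u p x \<longleftrightarrow> is_walk P u p x"
proof (rule awalk_iff_if_predecessor_closed[OF wf_attach wf_P _ _ assms])
  show "pverts P \<subseteq> pverts (attach P G B)" by (auto simp: attach_def)
  show "(y, x) \<in> parcs P \<longleftrightarrow> (y, x) \<in> parcs (attach P G B) \<and> x \<in> pverts P" for y x
    using B arcs_P mid_subset by (auto simp: attach_def)
qed

lemma cover_attach: "x \<in> pverts P \<Longrightarrow> cover (attach P G B) x = cover P x"
proof -
  assume x: "x \<in> pverts P"
  interpret P: pair_wf_digraph P by (rule wf_P)
  interpret H: pair_wf_digraph "attach P G B" by (rule wf_attach)
  show ?thesis
    using x by (simp add: cover_def P.reachable_awalk H.reachable_awalk awalk_attach_iff attach_parts)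
qed

text \<open>The last arc of the path enters a right node and so lies in \<open>B\<close>, while the
  rest ends in \<open>P\<close> and therefore is a walk of \<open>P\<close>. Counting paths to
  \<open>Rgt v\<close> becomes counting pairs of an arc of \<open>B\<close> and a walk to its
  tail.\<close>

lemma apath_attach_Rgt_iff:
  "is_path (attach P G B) (Lft u) p (Rgt v) \<longleftrightarrow>
     (\<exists>x q. p = q @ [(x, Rgt v)] \<and> (x, Rgt v) \<in> B \<and> is_walk P (Lft u) q x)"
proof -
  interpret H: pair_wf_digraph "attach P G B" by (rule wf_attach)
  have "is_walk (attach P G B) (Lft u) p (Rgt v) \<longleftrightarrow>
    (\<exists>x q. p = q @ [(x, Rgt v)] \<and> (x, Rgt v) \<in> B \<and> is_walk P (Lft u) q x)"
  proof (cases p rule: rev_exhaust)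
    case Nil
    then show ?thesis by (auto simp: H.awalk_Nil_iff)
  next
    case (snoc q a)
    obtain y z where a: "a = (y, z)" by (cases a)
    have "(y, Rgt v) \<in> parcs (attach P G B) \<longleftrightarrow> (y, Rgt v) \<in> B"
      using arcs_P mid_subset by (auto simp: attach_def)
    moreover have "(y, Rgt v) \<in> B \<Longrightarrow> y \<in> pverts P"
      using B by auto
    ultimately show ?thesis
      unfolding snoc a H.awalk_snoc_iff using awalk_attach_iff by auto
  qed
  then show ?thesis by (simp add: H.apath_iff_awalk_if_acyclic[OF acyclic_attach])
qed

lemma is_hag_attach_iff_paths:
  "is_hag G (attach P G B) \<longleftrightarrow> (\<forall>u \<in> pverts G. \<forall>v \<in> pverts G.
     ((u, v) \<in> parcs G \<longrightarrow> (\<exists>!p. is_path (attach P G B) (Lft u) p (Rgt v))) \<and>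
     ((u, v) \<notin> parcs G \<longrightarrow> \<not> (\<exists>p. is_path (attach P G B) (Lft u) p (Rgt v))))"
proof -
  have 1: "parcs (attach P G B) \<subseteq> left_part P \<times> mid_part P \<union> mid_part P \<times> mid_part P
              \<union> mid_part P \<times> Rgt ` pverts G \<union> left_part P \<times> Rgt ` pverts G"
    using arcs_P B verts_P by (auto simp: attach_def)
  have "inj_on (cover (attach P G B)) (mid_part P)"
    using inj_cover_P cover_attach mid_subset by (metis inj_on_cong subsetD)
  moreover have "finite (pverts (attach P G B))"
    using finite_P finite_G by (simp add: attach_def)
  ultimately show ?thesis
    unfolding is_hag_def attach_parts using 1 left_P acyclic_attach by simp
qed

text \<open>Two in-neighbours of \<open>Rgt v\<close> whose covers share a node give paths with
  different last arcs, so unique paths force disjoint covers. Conversely, a unique covering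
  in-neighbour fixes the last arc, and \<open>unambiguous_edges\<close> fixes the walk before
  it.\<close>

lemma is_hag_attach_iff:
  assumes unamb: "unambiguous_edges P G"
  shows "is_hag G (attach P G B) \<longleftrightarrow>
     (\<forall>x v. (x, Rgt v) \<in> B \<longrightarrow> cover P x \<subseteq> in_nbrs (gnn_graph G) (Rgt v)) \<and>
     (\<forall>(u, v) \<in> parcs G. \<exists>!x. (x, Rgt v) \<in> B \<and> Lft u \<in> cover P x)"
    (is "_ \<longleftrightarrow> ?C \<and> ?U")
proof
  assume hag: "is_hag G (attach P G B)"
  note paths = this[unfolded is_hag_attach_iff_paths apath_attach_Rgt_iff]
  have ?C
  proof (intro allI impI subsetI)
    fix x v w assume "(x, Rgt v) \<in> B" "w \<in> cover P x"
    moreover from this obtain u p where "w = Lft u" "u \<in> pverts G" "is_walk P (Lft u) p x"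
      by (auto simp: cover_iff left_P)
    moreover have "v \<in> pverts G" using \<open>(x, Rgt v) \<in> B\<close> B by auto
    ultimately show "w \<in> in_nbrs (gnn_graph G) (Rgt v)"
      using paths unfolding in_nbrs_gnn by blast
  qed
  moreover have "\<exists>!x. (x, Rgt v) \<in> B \<and> Lft u \<in> cover P x" if uv: "(u, v) \<in> parcs G" for u v
  proof -
    have V: "u \<in> pverts G" "v \<in> pverts G" using uv arcs_G by auto
    then have uni: "\<exists>!p. \<exists>x q. p = q @ [(x, Rgt v)] \<and> (x, Rgt v) \<in> B \<and> is_walk P (Lft u) q x"
      using paths[THEN bspec, OF V(1), THEN bspec, OF V(2)] uv by simp
    have "Lft u \<in> left_part P" using V left_P by auto
    then have cov: "Lft u \<in> cover P x \<longleftrightarrow> (\<exists>q. is_walk P (Lft u) q x)" for x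
      by (simp add: cover_iff)
    show ?thesis
    proof (rule ex_ex1I)
      show "\<exists>x. (x, Rgt v) \<in> B \<and> Lft u \<in> cover P x" using uni cov by blast
    next
      fix x y assume "(x, Rgt v) \<in> B \<and> Lft u \<in> cover P x" "(y, Rgt v) \<in> B \<and> Lft u \<in> cover P y"
      then obtain p q where pq: "(x, Rgt v) \<in> B" "is_walk P (Lft u) p x"
        "(y, Rgt v) \<in> B" "is_walk P (Lft u) q y" using cov by blast
      from uni pq have "p @ [(x, Rgt v)] = q @ [(y, Rgt v)]" by blast
      then show "x = y" by simp
    qed
  qed
  ultimately show "?C \<and> ?U" by blast
next
  interpret P: pair_wf_digraph P by (rule wf_P)
  assume CU: "?C \<and> ?U"
  have arc_if: "(u, v) \<in> parcs G"
    if "(x, Rgt v) \<in> B" "is_walk P (Lft u) q x" "u \<in> pverts G" for u v x q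
  proof -
    from that have "Lft u \<in> cover P x" using left_P by (auto simp: cover_iff)
    then show ?thesis using CU that(1) in_nbrs_gnn[of v] by blast
  qed
  \<comment> \<open>Paths with the same last arc could still differ before it. For an intermediate
    tail \<open>unambiguous_edges\<close> excludes this, as the cover of the tail lies in the
    in-neighbourhood of \<open>Rgt v\<close>; a left tail is reached by the empty walk only.\<close>
  have unique: "p = q"
    if x: "(x, Rgt v) \<in> B" and p: "is_walk P (Lft u) p x" and q: "is_walk P (Lft u) q x"
      and u: "u \<in> pverts G" for u v x p q
  proof (cases "x \<in> mid_part P")
    case True
    have "v \<in> pverts G" using x B by auto
    moreover have "cover P x \<subseteq> in_nbrs (gnn_graph G) (Rgt v)" using CU x by blast
    moreover have "Lft u \<in> cover P x" using p u left_P by (auto simp: cover_iff)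
    ultimately have "\<exists>!p. is_path P (Lft u) p x"
      using unamb True unfolding unambiguous_edges_def right_gnn by blast
    then show ?thesis using p q P.apath_iff_awalk_if_acyclic[OF acyclic_P] by blast
  next
    case False
    have "x \<in> pverts P" using x B by auto
    then obtain w where "x = Lft w" using False by (rule LftE)
    then show ?thesis using p q by (simp add: Lft_awalk_iff)
  qed
  show "is_hag G (attach P G B)"
    unfolding is_hag_attach_iff_paths apath_attach_Rgt_iff
  proof (intro ballI conjI impI)
    fix u v assume V: "u \<in> pverts G" "v \<in> pverts G"
    {
      assume "(u, v) \<in> parcs G"
      then have U: "\<exists>!x. (x, Rgt v) \<in> B \<and> Lft u \<in> cover P x" using CU by blast
      then obtain x where x: "(x, Rgt v) \<in> B" "Lft u \<in> cover P x" by blast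
      then obtain q where q: "is_walk P (Lft u) q x" by (auto simp: cover_iff)
      show "\<exists>!p. \<exists>x q. p = q @ [(x, Rgt v)] \<and> (x, Rgt v) \<in> B \<and> is_walk P (Lft u) q x"
      proof (rule ex1I[of _ "q @ [(x, Rgt v)]"])
        fix p assume "\<exists>x q. p = q @ [(x, Rgt v)] \<and> (x, Rgt v) \<in> B \<and> is_walk P (Lft u) q x"
        then obtain x' q' where p: "p = q' @ [(x', Rgt v)]"
          and x': "(x', Rgt v) \<in> B" "is_walk P (Lft u) q' x'" by blast
        then have "Lft u \<in> cover P x'" using V left_P by (auto simp: cover_iff)
        with U x x' have "x' = x" by blast
        moreover from this have "q' = q" using unique x' q V by blast
        ultimately show "p = q @ [(x, Rgt v)]" using p by simp
      qed (use x q in blast)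
    next
      assume "(u, v) \<notin> parcs G"
      then show "\<not> (\<exists>p x q. p = q @ [(x, Rgt v)] \<and> (x, Rgt v) \<in> B \<and> is_walk P (Lft u) q x)"
        using arc_if V by blast
    }
  qed
qed

end

text \<open>In a HAG graph no arc leaves a right node, so every arc either lies inside the induced
  subgraph \<open>P\<close> or runs from \<open>P\<close> to a right node. The arcs of the second
  kind form the witness \<open>B\<close>.\<close>

lemma attach_if_extending:
  assumes H: "H \<in> hags_extending P G"
  obtains B where "B \<subseteq> pverts P \<times> Rgt ` pverts G" and "H = attach P G B"
proof
  let ?B = "parcs H \<inter> pverts P \<times> Rgt ` pverts G"
  show "?B \<subseteq> pverts P \<times> Rgt ` pverts G" by blast
  have hag: "is_hag G H" and ind: "induces H P" using H by (auto simp: hags_extending_def)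
  have vP: "pverts P = left_part H \<union> mid_part H"
    and aP: "parcs P = parcs H \<inter> pverts P \<times> pverts P"
    using ind unfolding induces_iff by auto
  have "pverts H = left_part H \<union> mid_part H \<union> right_part H"
  proof -
    have "x \<in> range Lft \<union> range Mid \<union> range Rgt" for x :: "('v, 'm) node" by (cases x) auto
    then show ?thesis unfolding left_part_def mid_part_def right_part_def by blast
  qed
  moreover have right: "right_part H = Rgt ` pverts G" using hag by (simp add: is_hag_def)
  ultimately have "pverts H = pverts (attach P G ?B)" by (simp add: vP attach_def)
  moreover have "parcs H = parcs (attach P G ?B)"
  proof -
    have "parcs H \<subseteq> pverts P \<times> pverts P \<union> pverts P \<times> Rgt ` pverts G"
      using hag unfolding is_hag_def vP right by blast
    then show ?thesis using aP by (auto simp: attach_def)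
  qed
  ultimately show "H = attach P G ?B" by simp
qed

section \<open>Matchings and the HAG graphs they give\<close>

lemma hedges_cover_hypergraph_iff:
  "(r, e) \<in> hedges (cover_hypergraph P G) \<longleftrightarrow>
     r \<in> Rgt ` pverts G \<and> e \<in> cover P ` mid_part P \<and> e \<subseteq> in_nbrs (gnn_graph G) r"
  by (simp add: cover_hypergraph_def hyper_disjoint_union_def cover_hypergraph_at_def right_gnn)
    blast

lemma hends_cover_hypergraph: "hends (cover_hypergraph P G) (r, e) = {r} \<times> e"
  by (simp add: cover_hypergraph_def hyper_disjoint_union_def cover_hypergraph_at_def)

text \<open>The vertex set of \<open>(r, e)\<close> is tagged by \<open>r\<close>, so edges at
  different right nodes are disjoint automatically and only edges at the same \<open>r\<close> have
  to be compared.\<close>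

lemma matching_iff:
  "N \<in> matchings (cover_hypergraph P G) \<longleftrightarrow>
     (\<forall>r e. (r, e) \<in> N \<longrightarrow>
        r \<in> Rgt ` pverts G \<and> e \<in> cover P ` mid_part P \<and> e \<subseteq> in_nbrs (gnn_graph G) r) \<and>
     (\<forall>r e e'. (r, e) \<in> N \<longrightarrow> (r, e') \<in> N \<longrightarrow> e \<noteq> e' \<longrightarrow> e \<inter> e' = {})"
  (is "_ \<longleftrightarrow> ?E \<and> ?D")
proof -
  have "N \<subseteq> hedges (cover_hypergraph P G) \<longleftrightarrow> ?E"
    unfolding hedges_cover_hypergraph_iff[symmetric] by auto
  moreover have
    "pairwise (\<lambda>e f. disjnt (hends (cover_hypergraph P G) e) (hends (cover_hypergraph P G) f)) N \<longleftrightarrow> ?D"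
    (is "pairwise ?R N \<longleftrightarrow> _")
  proof -
    have "?R (r, e) (r', e') \<longleftrightarrow> r \<noteq> r' \<or> e \<inter> e' = {}" for r e r' e'
      by (auto simp: hends_cover_hypergraph disjnt_def)
    then have "pairwise ?R N \<longleftrightarrow> (\<forall>r e r' e'. (r, e) \<in> N \<longrightarrow> (r', e') \<in> N \<longrightarrow>
        (r, e) \<noteq> (r', e') \<longrightarrow> r \<noteq> r' \<or> e \<inter> e' = {})"
      unfolding pairwise_def by (simp add: Ball_def split_paired_All)
    then show ?thesis by blast
  qed
  ultimately show ?thesis by (simp add: matchings_def)
qed

lemma matchingD:
  assumes "N \<in> matchings (cover_hypergraph P G)" and "(r, e) \<in> N"
  shows "r \<in> Rgt ` pverts G" and "e \<in> cover P ` mid_part P" and "e \<subseteq> in_nbrs (gnn_graph G) r"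
    and "\<And>e'. (r, e') \<in> N \<Longrightarrow> e \<noteq> e' \<Longrightarrow> e \<inter> e' = {}"
  using assms unfolding matching_iff by simp_all

lemma matching_arcs_subset:
  assumes "N \<in> matchings (cover_hypergraph P G)"
  shows "matching_arcs P G N \<subseteq> pverts P \<times> Rgt ` pverts G"
proof
  fix a assume "a \<in> matching_arcs P G N"
  then consider x r where "a = (x, r)" "x \<in> mid_part P" "(r, cover P x) \<in> N"
    | u v where "a = (Lft u, Rgt v)" "(u, v) \<in> parcs G"
    by (auto simp: matching_arcs_def)
  then show "a \<in> pverts P \<times> Rgt ` pverts G"
  proof cases
    case 1
    then show ?thesis using matchingD(1)[OF assms] mid_subset by blast
  next
    case 2
    then show ?thesis using arcs_G by (auto simp: Lft_in_iff)
  qed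
qed

lemma mid_matching_arcs_iff:
  "x \<in> mid_part P \<Longrightarrow> (x, r) \<in> matching_arcs P G N \<longleftrightarrow> (r, cover P x) \<in> N"
  by (auto simp: matching_arcs_def)

lemma Lft_matching_arcs_iff:
  "(Lft u, Rgt v) \<in> matching_arcs P G N \<longleftrightarrow>
     (u, v) \<in> parcs G \<and> (\<forall>e. (Rgt v, e) \<in> N \<longrightarrow> Lft u \<notin> e)"
  by (auto simp: matching_arcs_def)

text \<open>If a matched edge at \<open>Rgt v\<close> contains \<open>Lft u\<close>, the node with
  this cover is the required in-neighbour: disjoint edges and distinct covers exclude other
  intermediate nodes, and \<open>Lft u\<close> is not joined directly. Otherwise
  \<open>Lft u\<close> itself is the only choice.\<close>

lemma attach_matching_extending:
  assumes N: "N \<in> matchings (cover_hypergraph P G)" and unamb: "unambiguous_edges P G"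
  shows "attach P G (matching_arcs P G N) \<in> hags_extending P G"
proof -
  let ?B = "matching_arcs P G N"
  note B = matching_arcs_subset[OF N]
  have edge: "\<And>r e. (r, e) \<in> N \<Longrightarrow> e \<in> cover P ` mid_part P \<and> e \<subseteq> in_nbrs (gnn_graph G) r"
    and disj: "\<And>r e e'. (r, e) \<in> N \<Longrightarrow> (r, e') \<in> N \<Longrightarrow> e \<noteq> e' \<Longrightarrow> e \<inter> e' = {}"
    using matchingD[OF N] by simp_all
  have "cover P x \<subseteq> in_nbrs (gnn_graph G) (Rgt v)" if x: "(x, Rgt v) \<in> ?B" for x v
  proof (cases "x \<in> mid_part P")
    case True
    then show ?thesis using x edge by (auto simp: mid_matching_arcs_iff)
  next
    case False
    then obtain u where "x = Lft u" "(u, v) \<in> parcs G" using x by (auto simp: matching_arcs_def)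
    moreover from this have "u \<in> pverts G" using arcs_G by auto
    ultimately show ?thesis by (auto simp: cover_Lft in_nbrs_gnn)
  qed
  moreover have "\<exists>!x. (x, Rgt v) \<in> ?B \<and> Lft u \<in> cover P x" if uv: "(u, v) \<in> parcs G" for u v
  proof (cases "\<exists>e. (Rgt v, e) \<in> N \<and> Lft u \<in> e")
    case True
    then obtain x where x: "x \<in> mid_part P" "(Rgt v, cover P x) \<in> N" "Lft u \<in> cover P x"
      using edge by blast
    show ?thesis
    proof (rule ex1I[of _ x])
      show "(x, Rgt v) \<in> ?B \<and> Lft u \<in> cover P x" using x by (simp add: mid_matching_arcs_iff)
    next
      fix y assume y: "(y, Rgt v) \<in> ?B \<and> Lft u \<in> cover P y"
      show "y = x"
      proof (cases "y \<in> mid_part P")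
        case True
        then have "(Rgt v, cover P y) \<in> N" using y by (simp add: mid_matching_arcs_iff)
        then have "cover P y = cover P x" using disj[of "Rgt v" "cover P y" "cover P x"] x y by blast
        then show ?thesis using inj_cover_P True x(1) by (auto dest: inj_onD)
      next
        case False
        then obtain w where w: "y = Lft w" "(w, v) \<in> parcs G" using y by (auto simp: matching_arcs_def)
        then have "w \<in> pverts G" using arcs_G by auto
        then have "w = u" using y w by (simp add: cover_Lft)
        then show ?thesis using x y w Lft_matching_arcs_iff by blast
      qed
    qed
  next
    case False
    have u: "u \<in> pverts G" using uv arcs_G by auto
    show ?thesis
    proof (rule ex1I[of _ "Lft u"])
      show "(Lft u, Rgt v) \<in> ?B \<and> Lft u \<in> cover P (Lft u)"
        using False uv u by (auto simp: cover_Lft Lft_matching_arcs_iff)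
    next
      fix y assume y: "(y, Rgt v) \<in> ?B \<and> Lft u \<in> cover P y"
      then have "y \<notin> mid_part P" using False by (auto simp: mid_matching_arcs_iff)
      then obtain w where w: "y = Lft w" "(w, v) \<in> parcs G" using y by (auto simp: matching_arcs_def)
      then have "w \<in> pverts G" using arcs_G by auto
      then show "y = Lft u" using y w by (simp add: cover_Lft)
    qed
  qed
  ultimately have "is_hag G (attach P G ?B)"
    unfolding is_hag_attach_iff[OF B unamb] by blast
  then show ?thesis using induces_attach[OF B] by (simp add: hags_extending_def)
qed

text \<open>The inverse of the bijection, reading the matching off the arcs from intermediate to
  right nodes. Covers are taken in \<open>P\<close>; by \<open>cover_attach\<close> they agree with
  those in an extension.\<close>

definition mid_edges :: "('v, 'm) node pair_pre_digraph \<Rightarrow> (('v, 'm) node \<times> ('v, 'm) node set) set" where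
  "mid_edges H = {(Rgt v, cover P x) | x v. x \<in> mid_part P \<and> (x, Rgt v) \<in> parcs H}"

lemma mid_edges_attach_matching:
  assumes N: "N \<in> matchings (cover_hypergraph P G)"
  shows "mid_edges (attach P G (matching_arcs P G N)) = N"
proof -
  have "(r, e) \<in> mid_edges (attach P G (matching_arcs P G N)) \<longleftrightarrow> (r, e) \<in> N" for r e
  proof -
    have "(x, Rgt v) \<notin> parcs P" for x v using arcs_P mid_subset by auto
    then have "x \<in> mid_part P \<and> (x, Rgt v) \<in> parcs (attach P G (matching_arcs P G N)) \<longleftrightarrow>
        x \<in> mid_part P \<and> (Rgt v, cover P x) \<in> N" for x v
      by (auto simp: attach_def matching_arcs_def)
    then have "(r, e) \<in> mid_edges (attach P G (matching_arcs P G N)) \<longleftrightarrow>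
      (\<exists>x v. r = Rgt v \<and> e = cover P x \<and> x \<in> mid_part P \<and> (Rgt v, cover P x) \<in> N)"
      by (simp add: mid_edges_def)
    also have "\<dots> \<longleftrightarrow> (r, e) \<in> N" using matchingD(1,2)[OF N] by blast
    finally show ?thesis .
  qed
  then show ?thesis by auto
qed

text \<open>Both claims come from the criterion \<open>is_hag_attach_iff\<close>. Arcs from
  intermediate nodes are recovered because covers are distinct; the direct arcs are forced, since
  \<open>Lft u\<close> must be covered exactly once at each \<open>Rgt v\<close> with
  \<open>(u, v)\<close> an arc of \<open>G\<close>.\<close>

lemma mid_edges_extending:
  assumes H: "H \<in> hags_extending P G" and unamb: "unambiguous_edges P G"
  shows "mid_edges H \<in> matchings (cover_hypergraph P G)"
    and "attach P G (matching_arcs P G (mid_edges H)) = H"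
proof -
  obtain B where B: "B \<subseteq> pverts P \<times> Rgt ` pverts G" and HB: "H = attach P G B"
    using attach_if_extending[OF H] .
  have "is_hag G (attach P G B)" using H HB by (simp add: hags_extending_def)
  then have C: "\<And>x v. (x, Rgt v) \<in> B \<Longrightarrow> cover P x \<subseteq> in_nbrs (gnn_graph G) (Rgt v)"
    and U: "\<And>u v. (u, v) \<in> parcs G \<Longrightarrow> \<exists>!x. (x, Rgt v) \<in> B \<and> Lft u \<in> cover P x"
    unfolding is_hag_attach_iff[OF B unamb] by blast+
  have arcs: "(x, Rgt v) \<in> parcs H \<longleftrightarrow> (x, Rgt v) \<in> B" for x v
    using arcs_P mid_subset by (auto simp: HB attach_def)
  have edges: "(r, e) \<in> mid_edges H \<longleftrightarrow>
      (\<exists>x v. r = Rgt v \<and> e = cover P x \<and> x \<in> mid_part P \<and> (x, Rgt v) \<in> B)" for r e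
    by (auto simp: mid_edges_def arcs)
  \<comment> \<open>A common element of two covers is some \<open>Lft u\<close> with
    \<open>(u, v)\<close> an arc of \<open>G\<close>, and its covering in-neighbour is
    unique.\<close>
  have same: "x = y" if xy: "(x, Rgt v) \<in> B" "(y, Rgt v) \<in> B" "w \<in> cover P x" "w \<in> cover P y" for x y v w
  proof -
    obtain u where "w = Lft u" "(u, v) \<in> parcs G"
      using C[OF xy(1)] xy(3) unfolding in_nbrs_gnn by auto
    then show ?thesis using U xy by blast
  qed
  show "mid_edges H \<in> matchings (cover_hypergraph P G)"
    unfolding matching_iff
  proof (intro conjI allI impI)
    fix r e assume "(r, e) \<in> mid_edges H"
    then obtain x v where "r = Rgt v" "e = cover P x" "x \<in> mid_part P" "(x, Rgt v) \<in> B"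
      by (auto simp: edges)
    then show "r \<in> Rgt ` pverts G" "e \<in> cover P ` mid_part P" "e \<subseteq> in_nbrs (gnn_graph G) r"
      using C B by auto
  next
    fix r e e' assume "(r, e) \<in> mid_edges H" "(r, e') \<in> mid_edges H" "e \<noteq> e'"
    then show "e \<inter> e' = {}" using same by (auto simp: edges)
  qed
  have "(x, Rgt v) \<in> matching_arcs P G (mid_edges H) \<longleftrightarrow> (x, Rgt v) \<in> B" for x v
  proof (cases "x \<in> mid_part P")
    case True
    then show ?thesis using inj_cover_P by (auto simp: mid_matching_arcs_iff edges dest: inj_onD)
  next
    case False
    show ?thesis
    proof (cases x)
      case (Lft u)
      have "(Lft u, Rgt v) \<in> matching_arcs P G (mid_edges H)" if b: "(Lft u, Rgt v) \<in> B"
      proof -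
        have "u \<in> pverts G" using b B by (auto simp: Lft_in_iff)
        then have cov: "cover P (Lft u) = {Lft u}" by (rule cover_Lft)
        then have "(u, v) \<in> parcs G" using C[OF b] in_nbrs_gnn[of v] by auto
        moreover have "Lft u \<notin> e" if e: "(Rgt v, e) \<in> mid_edges H" for e
        proof
          assume "Lft u \<in> e"
          then obtain y where y: "y \<in> mid_part P" "(y, Rgt v) \<in> B" "Lft u \<in> cover P y"
            using e by (auto simp: edges)
          then have "y = Lft u" using same b cov by blast
          then show False using y(1) by simp
        qed
        ultimately show ?thesis by (simp add: Lft_matching_arcs_iff)
      qed
      \<comment> \<open>The in-neighbour \<open>y\<close> covering \<open>Lft u\<close> is not
        intermediate, or its cover would be a matched edge containing \<open>Lft u\<close>. A left
        node covers only itself, so \<open>y\<close> is \<open>Lft u\<close>.\<close>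
      moreover have "(Lft u, Rgt v) \<in> B" if m: "(Lft u, Rgt v) \<in> matching_arcs P G (mid_edges H)"
      proof -
        from m have uv: "(u, v) \<in> parcs G" and no: "\<And>e. (Rgt v, e) \<in> mid_edges H \<Longrightarrow> Lft u \<notin> e"
          by (auto simp: Lft_matching_arcs_iff)
        obtain y where y: "(y, Rgt v) \<in> B" "Lft u \<in> cover P y" using U[OF uv] by blast
        then have "y \<notin> mid_part P" using no edges by blast
        with y(1) B obtain w where w: "y = Lft w" "w \<in> pverts G" by (auto elim: LftE)
        then have "w = u" using y by (simp add: cover_Lft)
        then show ?thesis using y w by simp
      qed
      ultimately show ?thesis using Lft by blast
    next
      case (Mid m)
      then show ?thesis using False B by (auto simp: matching_arcs_def mid_part_def)
    next
      case (Rgt w)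
      then show ?thesis using False B by (auto simp: matching_arcs_def)
    qed
  qed
  \<comment> \<open>The equivalence above concerns heads of the form \<open>Rgt v\<close> only;
    neither set has arcs with other heads.\<close>
  moreover have "r \<in> range Rgt" if "(x, r) \<in> matching_arcs P G (mid_edges H) \<union> B" for x r
    using that B by (auto simp: matching_arcs_def edges)
  ultimately have "(x, r) \<in> matching_arcs P G (mid_edges H) \<longleftrightarrow> (x, r) \<in> B" for x r
    by (metis UnCI rangeE)
  then have "matching_arcs P G (mid_edges H) = B" by auto
  then show "attach P G (matching_arcs P G (mid_edges H)) = H" by (simp add: HB)
qed

lemma bij_betw_attach_matching:
  assumes "unambiguous_edges P G"
  shows "bij_betw (\<lambda>N. attach P G (matching_arcs P G N))
    (matchings (cover_hypergraph P G)) (hags_extending P G)"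
proof (rule bij_betw_byWitness[where f' = mid_edges])
  show "(\<lambda>N. attach P G (matching_arcs P G N)) ` matchings (cover_hypergraph P G) \<subseteq> hags_extending P G"
    using attach_matching_extending[OF _ assms] by blast
  show "mid_edges ` hags_extending P G \<subseteq> matchings (cover_hypergraph P G)"
    using mid_edges_extending(1)[OF _ assms] by blast
qed (simp_all add: mid_edges_attach_matching mid_edges_extending(2)[OF _ assms])

section \<open>In-degrees, costs and matching values\<close>

lemma card_in_nbrs_matching:
  assumes N: "N \<in> matchings (cover_hypergraph P G)" and v: "v \<in> pverts G"
  shows "real (card (in_nbrs (gnn_graph G :: ('v, 'm) node pair_pre_digraph) (Rgt v))) =
    real (card (in_nbrs (attach P G (matching_arcs P G N)) (Rgt v))) +
    (\<Sum>e \<in> {e. (Rgt v, e) \<in> N}. real (card e) - 1)"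
proof -
  let ?I = "in_nbrs (gnn_graph G :: ('v, 'm) node pair_pre_digraph) (Rgt v)"
  let ?N = "{e. (Rgt v, e) \<in> N}"
  let ?M = "{x \<in> mid_part P. cover P x \<in> ?N}"
  have edge: "\<And>e. e \<in> ?N \<Longrightarrow> e \<in> cover P ` mid_part P \<and> e \<subseteq> ?I"
    and disj: "pairwise disjnt ?N"
    using matchingD[OF N] by (simp_all add: pairwise_def disjnt_def)
  have fin_I: "finite ?I"
  proof -
    have "?I \<subseteq> Lft ` pverts G" using arcs_G by (auto simp: in_nbrs_gnn)
    then show ?thesis using finite_G finite_surj by blast
  qed
  have fin_M: "finite ?M" by (rule finite_subset[OF _ finite_P]) (use mid_subset in auto)
  have bij: "bij_betw (cover P) ?M ?N"
    using edge inj_cover_P by (auto simp: bij_betw_def intro: inj_on_subset)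
  have Un: "\<Union> ?N \<subseteq> ?I" using edge by blast
  \<comment> \<open>Each matched edge \<open>e\<close> trades \<open>card e\<close> left
    in-neighbours for one intermediate node. This also holds for an empty cover: its weight is
    \<open>-1\<close>, and its arc raises the in-degree by one.\<close>
  have "in_nbrs (attach P G (matching_arcs P G N)) (Rgt v) = ?M \<union> (?I - \<Union> ?N)"
  proof -
    have "(x, Rgt v) \<notin> parcs P" for x using arcs_P mid_subset by auto
    then show ?thesis
      by (auto simp: in_nbrs_def attach_def matching_arcs_def gnn_graph_def)
  qed
  moreover have "?M \<inter> ?I = {}" by (auto simp: in_nbrs_gnn)
  ultimately have "card (in_nbrs (attach P G (matching_arcs P G N)) (Rgt v)) = card ?M + card (?I - \<Union> ?N)"
    using fin_M fin_I by (simp add: card_Un_disjoint Int_Diff disjoint_iff)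
  moreover have "card ?M = card ?N" using bij by (rule bij_betw_same_card)
  moreover have "card ?I = card (?I - \<Union> ?N) + card (\<Union> ?N)"
    using card_Diff_subset[OF finite_subset[OF Un fin_I] Un] card_mono[OF fin_I Un] by simp
  moreover have "card (\<Union> ?N) = (\<Sum>e \<in> ?N. card e)"
    by (rule card_Union_disjoint[OF disj]) (use edge fin_I finite_subset in blast)
  ultimately show ?thesis by (simp add: sum_subtractf)
qed

text \<open>Grouping the edges by right node makes the sum comparable with in-degrees node by
  node.\<close>

lemma matching_value_eq:
  assumes N: "N \<in> matchings (cover_hypergraph P G)"
  shows "matching_value (cover_hypergraph P G) N =
    (\<Sum>v \<in> pverts G. \<Sum>e \<in> {e. (Rgt v, e) \<in> N}. real (card e) - 1)"
proof -
  have fin: "finite {e. (r, e) \<in> N}" for r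
  proof (rule finite_subset)
    show "{e. (r, e) \<in> N} \<subseteq> cover P ` mid_part P" using matchingD(2)[OF N] by blast
    show "finite (cover P ` mid_part P)" using finite_subset[OF mid_subset finite_P] by simp
  qed
  have "N = (SIGMA r : Rgt ` pverts G. {e. (r, e) \<in> N})" using matchingD(1)[OF N] by auto
  then have "matching_value (cover_hypergraph P G) N =
    (\<Sum>(r, e) \<in> (SIGMA r : Rgt ` pverts G. {e. (r, e) \<in> N}). real (card e) - 1)"
    by (simp add: matching_value_def cover_hypergraph_def hyper_disjoint_union_def
        cover_hypergraph_at_def)
  also have "\<dots> = (\<Sum>r \<in> Rgt ` pverts G. \<Sum>e \<in> {e. (r, e) \<in> N}. real (card e) - 1)"
    by (rule sum.Sigma[symmetric]) (use finite_G fin in auto)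
  also have "\<dots> = (\<Sum>v \<in> pverts G. \<Sum>e \<in> {e. (Rgt v, e) \<in> N}. real (card e) - 1)"
    by (subst sum.reindex) (auto simp: inj_on_def)
  finally show ?thesis .
qed

text \<open>The two costs are compared part by part. Update costs cancel because the right parts
  agree, right nodes account for the matching value by \<open>card_in_nbrs_matching\<close>, and the
  in-degrees of intermediate nodes are those in \<open>P\<close>.\<close>

lemma hag_value_attach_matching:
  assumes N: "N \<in> matchings (cover_hypergraph P G)" and "cAgg \<noteq> 0"
  shows "hag_value cAgg cUp G (attach P G (matching_arcs P G N)) =
    matching_value (cover_hypergraph P G) N -
    (\<Sum>w \<in> mid_part P. real (card (in_nbrs P w)) - 1)"
proof -
  let ?H = "attach P G (matching_arcs P G N)"
  let ?I = "gnn_graph G :: ('v, 'm) node pair_pre_digraph"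
  define d where "d H w = real (card (in_nbrs H w)) - 1" for H and w :: "('v, 'm) node"
  note B = matching_arcs_subset[OF N]
  have fin: "finite (left_part P)" "finite (mid_part P)" "finite (Rgt ` pverts G :: ('v, 'm) node set)"
    using finite_P finite_G by (auto simp: left_part_def mid_part_def)
  \<comment> \<open>Left nodes contribute \<open>-1\<close> each to both costs, so they
    cancel.\<close>
  have "in_nbrs ?H (Lft u) = {}" "in_nbrs ?I (Lft u) = {}" for u
    using B arcs_P by (auto simp: in_nbrs_def attach_def gnn_graph_def)
  then have left: "sum (d ?H) (left_part P) = sum (d ?I) (left_part P)"
    by (intro sum.cong) (auto simp: d_def left_P)
  have mid: "sum (d ?H) (mid_part P) = sum (d P) (mid_part P)"
  proof (rule sum.cong[OF refl])
    fix x assume "x \<in> mid_part P"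
    then have "in_nbrs ?H x = in_nbrs P x"
      using B by (auto simp: in_nbrs_def attach_def mid_part_def)
    then show "d ?H x = d P x" by (simp add: d_def)
  qed
  have "sum (d ?I) (Rgt ` pverts G) - sum (d ?H) (Rgt ` pverts G) =
    (\<Sum>v \<in> pverts G. d ?I (Rgt v) - d ?H (Rgt v))"
    by (simp add: sum.reindex inj_on_def sum_subtractf)
  also have "\<dots> = matching_value (cover_hypergraph P G) N"
    unfolding matching_value_eq[OF N]
    by (rule sum.cong) (simp_all add: d_def card_in_nbrs_matching[OF N])
  finally have right: "sum (d ?I) (Rgt ` pverts G) - sum (d ?H) (Rgt ` pverts G) =
    matching_value (cover_hypergraph P G) N" .
  have "pverts ?H = left_part P \<union> mid_part P \<union> Rgt ` pverts G"
    using verts_P by (simp add: attach_def)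
  moreover have disj: "left_part P \<inter> mid_part P = {}" "(left_part P \<union> mid_part P) \<inter> Rgt ` pverts G = {}"
    by (auto simp: left_part_def mid_part_def)
  ultimately have "sum (d ?H) (pverts ?H) =
      sum (d ?H) (left_part P) + sum (d ?H) (mid_part P) + sum (d ?H) (Rgt ` pverts G)"
    using fin by (simp only: sum.union_disjoint[OF _ _ disj(1)] sum.union_disjoint[OF _ _ disj(2)] finite_UnI)
  moreover have "sum (d ?I) (pverts ?I) = sum (d ?I) (left_part P) + sum (d ?I) (Rgt ` pverts G)"
  proof -
    have "pverts ?I = left_part P \<union> Rgt ` pverts G" by (simp add: gnn_graph_def left_P)
    moreover have disj: "left_part P \<inter> Rgt ` pverts G = {}" by (auto simp: left_part_def)
    ultimately show ?thesis using fin by (simp only: sum.union_disjoint[OF _ _ disj])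
  qed
  ultimately have "sum (d ?I) (pverts ?I) - sum (d ?H) (pverts ?H) =
      matching_value (cover_hypergraph P G) N - sum (d P) (mid_part P)"
    using left mid right by simp
  moreover have "hag_value cAgg cUp G ?H = sum (d ?I) (pverts ?I) - sum (d ?H) (pverts ?H)"
    using \<open>cAgg \<noteq> 0\<close>
    by (simp add: hag_value_def cost_def d_def attach_parts right_gnn field_simps)
  ultimately show ?thesis by (simp add: d_def)
qed

end

section \<open>From partial HAG graphs to the bijection\<close>

lemma partial_extension_if_partial_hag:
  assumes G: "pair_fin_digraph G" and P: "partial_hag P" and left: "left_part P = Lft ` pverts G"
  shows "partial_extension P G"
proof -
  interpret G: pair_fin_digraph G by (rule G)
  \<comment> \<open>\<open>G\<^sub>0\<close> has the same vertices as \<open>G\<close> but may have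
    other arcs, so \<open>H\<close> serves only as a source of properties of
    \<open>P\<close>.\<close>
  obtain G\<^sub>0 H where hag: "is_hag G\<^sub>0 H" and ind: "induces H P"
    using P unfolding partial_hag_def by blast
  have vP: "pverts P = left_part H \<union> mid_part H"
    and aP: "parcs P = parcs H \<inter> pverts P \<times> pverts P"
    using ind unfolding induces_iff by auto
  have L: "left_part P = left_part H" and M: "mid_part P = mid_part H"
    using vP by (auto simp: left_part_def mid_part_def)
  have arcs_H: "parcs H \<subseteq> pverts P \<times> mid_part H \<union> pverts P \<times> right_part H"
    using hag unfolding is_hag_def vP by blast
  have disj: "pverts P \<inter> right_part H = {}"
    unfolding vP by (auto simp: left_part_def mid_part_def right_part_def)
  have arcs_P: "parcs P \<subseteq> pverts P \<times> mid_part P"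
    using arcs_H aP disj M by blast
  interpret P: pair_wf_digraph P
    using arcs_P by unfold_locales (auto simp: mid_part_def)
  interpret H: pair_wf_digraph H
    using arcs_H vP by unfold_locales (auto simp: left_part_def mid_part_def right_part_def)
  have "pverts P \<subseteq> pverts H"
    using vP by (auto simp: left_part_def mid_part_def)
  moreover have "(y, x) \<in> parcs P \<longleftrightarrow> (y, x) \<in> parcs H \<and> x \<in> pverts P" for y x
    using aP arcs_H disj by auto
  \<comment> \<open>No arc of \<open>H\<close> enters \<open>P\<close> from outside, so covers in
    \<open>P\<close> and \<open>H\<close> agree and distinctness of covers carries over.\<close>
  ultimately have walk: "x \<in> pverts P \<Longrightarrow> is_walk H u p x \<longleftrightarrow> is_walk P u p x" for u p x
    by (intro awalk_iff_if_predecessor_closed H.pair_wf_digraph_axioms P.pair_wf_digraph_axioms)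
  have "cover P x = cover H x" if "x \<in> mid_part P" for x
    using that walk by (auto simp: cover_def P.reachable_awalk H.reachable_awalk L mid_part_def)
  moreover have "inj_on (cover H) (mid_part H)" "acyclic (parcs H)" "finite (pverts H)"
    using hag by (auto simp: is_hag_def)
  ultimately have "inj_on (cover P) (mid_part P)" "acyclic (parcs P)" "finite (pverts P)"
    using M aP vP by (auto simp: inj_on_def left_part_def mid_part_def intro: acyclic_subset)
  then show ?thesis
    using arcs_P left L M vP G.pair_finite_verts G.in_arcsD1 G.in_arcsD2
    by unfold_locales auto
qed

text \<open>That \<open>c\<close> is chosen before the cost constants and \<open>G\<close>, as a
  function of the partial graph, expresses that it depends on that graph alone. The witness is the
  contribution of the intermediate nodes to the sum in \<open>cost\<close>.\<close>

theorem lemma11: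
  shows "\<exists>c :: ('v, 'm) node pair_pre_digraph \<Rightarrow> real.
    (\<forall>d P. partial_d_hag d P \<longrightarrow> c P = real (card (mid_part P)) * (real d - 1)) \<and>
    (\<forall>(cAgg :: real) (cUp :: real) (G :: 'v pair_pre_digraph) P.
       cAgg \<noteq> 0 \<longrightarrow> pair_fin_digraph G \<longrightarrow> partial_hag P \<longrightarrow> left_part P = Lft ` pverts G \<longrightarrow>
       unambiguous_edges P G \<longrightarrow>
       (\<exists>\<phi>. bij_betw \<phi> (matchings (cover_hypergraph P G)) (hags_extending P G) \<and>
          (\<forall>N \<in> matchings (cover_hypergraph P G).
             hag_value cAgg cUp G (\<phi> N) = matching_value (cover_hypergraph P G) N - c P) \<and>
          (\<forall>N. is_arg_max (matching_value (cover_hypergraph P G))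
                 (\<lambda>N'. N' \<in> matchings (cover_hypergraph P G)) N \<longrightarrow>
               is_arg_max (hag_value cAgg cUp G) (\<lambda>H. H \<in> hags_extending P G) (\<phi> N))))"
proof (intro exI[of _ "\<lambda>P. \<Sum>w \<in> mid_part P. real (card (in_nbrs P w)) - 1"] conjI allI impI)
  fix d and P :: "('v, 'm) node pair_pre_digraph"
  assume "partial_d_hag d P"
  then show "(\<Sum>w \<in> mid_part P. real (card (in_nbrs P w)) - 1) = real (card (mid_part P)) * (real d - 1)"
    by (simp add: partial_d_hag_def)
next
  fix cAgg cUp :: real and G :: "'v pair_pre_digraph" and P :: "('v, 'm) node pair_pre_digraph"
  assume c: "cAgg \<noteq> 0" and "pair_fin_digraph G" "partial_hag P" "left_part P = Lft ` pverts G"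
    and unamb: "unambiguous_edges P G"
  then interpret partial_extension P G by (intro partial_extension_if_partial_hag)
  let ?\<phi> = "\<lambda>N. attach P G (matching_arcs P G N)"
  let ?c = "\<Sum>w \<in> mid_part P. real (card (in_nbrs P w)) - 1"
  note bij = bij_betw_attach_matching[OF unamb]
  note val = hag_value_attach_matching[OF _ c, of _ cUp]
  have "is_arg_max (hag_value cAgg cUp G) (\<lambda>H. H \<in> hags_extending P G) (?\<phi> N)"
    if N: "is_arg_max (matching_value (cover_hypergraph P G))
      (\<lambda>N'. N' \<in> matchings (cover_hypergraph P G)) N" for N
  proof -
    \<comment> \<open>Surjectivity turns every competitor into the image of a matching, and all
      values are shifted by the same constant.\<close>
    have "hag_value cAgg cUp G H \<le> hag_value cAgg cUp G (?\<phi> N)" if "H \<in> hags_extending P G" for H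
    proof -
      obtain N' where "N' \<in> matchings (cover_hypergraph P G)" "H = ?\<phi> N'"
        using \<open>H \<in> hags_extending P G\<close> bij unfolding bij_betw_def by blast
      then show ?thesis using N val by (auto simp: is_arg_max_linorder)
    qed
    then show ?thesis using N bij by (auto simp: is_arg_max_linorder bij_betw_def)
  qed
  with bij val show "\<exists>\<phi>. bij_betw \<phi> (matchings (cover_hypergraph P G)) (hags_extending P G) \<and>
      (\<forall>N \<in> matchings (cover_hypergraph P G).
         hag_value cAgg cUp G (\<phi> N) = matching_value (cover_hypergraph P G) N - ?c) \<and>
      (\<forall>N. is_arg_max (matching_value (cover_hypergraph P G))
             (\<lambda>N'. N' \<in> matchings (cover_hypergraph P G)) N \<longrightarrow>
           is_arg_max (hag_value cAgg cUp G) (\<lambda>H. H \<in> hags_extending P G) (\<phi> N))"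
    by blast
qed

end
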